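(* Let $\lambda$ be a nonzero real number. For every $k\in\mathbb{N}$ (that is, $k\ge1$), $$H_{k,\lambda}=\frac{1}{k!}\bigg(\frac{k!-\langle 1-\lambda \rangle_{k}}{\lambda}\bigg)=\frac{1}{\lambda}\bigg(1-\binom{k-\lambda}{k}\bigg).$$
   Context: Fix a nonzero real $\lambda$. Generating functions are formal power series, with $(1+u)^{a}=\sum_{j\ge0}\binom{a}{j}u^{j}$, where $\binom{a}{j}=\frac{a(a-1)\cdots(a-j+1)}{j!}$ for real $a$. Notation: $\langle\alpha\rangle_0=1$ and $\langle\alpha\rangle_k=\alpha(\alpha+1)\cdots(\alpha+k-1)$ for $k\ge1$. Degenerate logarithm: $\log_{\lambda}(1+t)=\frac{1}{\lambda}\big((1+t)^{\lambda}-1\big)$. Degenerate harmonic numbers $H_{n,\lambda}$: defined by $-\frac{\log_{\lambda}(1-t)}{1-t}=\sum_{n=1}^{\infty}H_{n,\lambda}t^{n}$. *)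

theory Defs
  imports Complex_Main "HOL-Computational_Algebra.Formal_Power_Series"
begin

text \<open>
  The series \<open>fps_binomial a\<close> is $(1+t)^a$, with coefficients \<open>a gchoose j\<close>.
\<close>

definition degenerate_log :: "real \<Rightarrow> real fps" where
  "degenerate_log lam = fps_const (1 / lam) * (fps_binomial lam - 1)"

text \<open>
  The composition with \<open>- fps_X\<close> turns $\log_\lambda(1+t)$ into $\log_\lambda(1-t)$.
\<close>

definition degenerate_harmonic_gf :: "real \<Rightarrow> real fps" where
  "degenerate_harmonic_gf lam = - (degenerate_log lam oo (- fps_X)) / (1 - fps_X)"

definition degenerate_harmonic :: "nat \<Rightarrow> real \<Rightarrow> real" where
  "degenerate_harmonic n lam = fps_nth (degenerate_harmonic_gf lam) n"

text \<open>
  The generating function has no constant term, so its expansion does start at $n = 1$.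
\<close>

lemma degenerate_harmonic_0: "degenerate_harmonic 0 lam = 0"
  by (simp add: degenerate_harmonic_def degenerate_harmonic_gf_def degenerate_log_def
      fps_divide_unit)

end

theory Submission
  imports Defs
begin

text \<open>
  Dividing $(1-t)^\lambda - 1$ by $1-t$ lowers the exponent by one, so
  \[ \sum_n H_{n,\lambda} t^n = \frac{1}{\lambda}\Big(\frac{1}{1-t} - (1-t)^{\lambda-1}\Big). \]
  The geometric series contributes $1$ to every coefficient, and by the binomial series the
  coefficient of $t^k$ in $(1-t)^{\lambda-1}$ is
  $(-1)^k\binom{\lambda-1}{k} = \langle 1-\lambda\rangle_k/k! = \binom{k-\lambda}{k}$.
  Hence both closed forms are read off from the same coefficient
  (lemma \<open>degenerate_harmonic_eq_gbinomial\<close>).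
\<close>

text \<open>
  Exponents of binomial series add, so the factor $1+t$ splits off from $(1+t)^a$ before
  $-t$ is substituted; a cancellation of $1-t$ is then all that remains.
\<close>

lemma fps_binomial_compose_uminus_X_divide:
  fixes a :: "'a :: field_char_0"
  shows "(fps_binomial a oo (- fps_X)) / (1 - fps_X) = fps_binomial (a - 1) oo (- fps_X)"
proof -
  have "fps_binomial a = fps_binomial (a - 1) * (1 + fps_X)"
    using fps_binomial_add_mult[of "a - 1" 1] by (simp add: fps_binomial_1)
  hence "fps_binomial a oo (- fps_X) = (fps_binomial (a - 1) oo (- fps_X)) * (1 - fps_X)"
    by (simp add: fps_compose_mult_distrib fps_compose_add_distrib)
  thus ?thesis
    by (simp add: fps_divide_unit mult.assoc inverse_mult_eq_1')
qed

lemma degenerate_harmonic_gf_eq: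
  "degenerate_harmonic_gf lam =
     fps_const (1 / lam) * (1 / (1 - fps_X) - (fps_binomial (lam - 1) oo (- fps_X)))"
proof -
  have "degenerate_log lam oo (- fps_X) =
          fps_const (1 / lam) * ((fps_binomial lam oo (- fps_X)) - 1)"
    by (simp add: degenerate_log_def fps_compose_mult_distrib fps_compose_sub_distrib)
  hence "degenerate_harmonic_gf lam =
      - (fps_const (1 / lam) * ((fps_binomial lam oo (- fps_X)) - 1)) / (1 - fps_X)"
    by (simp only: degenerate_harmonic_gf_def)
  also have "\<dots> =
      fps_const (1 / lam) *
        (1 / (1 - fps_X) - (fps_binomial lam oo (- fps_X)) / (1 - fps_X))"
    by (simp add: fps_divide_unit algebra_simps)
  finally show ?thesis
    by (simp only: fps_binomial_compose_uminus_X_divide)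
qed

lemma degenerate_harmonic_eq_gbinomial:
  "degenerate_harmonic k lam = (1 / lam) * (1 - (-1) ^ k * ((lam - 1) gchoose k))"
proof -
  have "fps_nth (1 / (1 - fps_X) :: real fps) k = 1"
    by (simp add: fps_divide_unit fps_inverse_one_minus_fps_X)
  moreover have "fps_nth (fps_binomial (lam - 1) oo (- fps_X)) k = (-1) ^ k * ((lam - 1) gchoose k)"
    by (simp add: fps_compose_uminus')
  ultimately show ?thesis
    by (simp add: degenerate_harmonic_def degenerate_harmonic_gf_eq)
qed

theorem theorem7:
  fixes lam :: real and k :: nat
  assumes "lam \<noteq> 0" and "k \<ge> 1"
  shows "degenerate_harmonic k lam = (1 / fact k) * ((fact k - pochhammer (1 - lam) k) / lam)
       \<and> (1 / fact k) * ((fact k - pochhammer (1 - lam) k) / lam)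
           = (1 / lam) * (1 - ((real k - lam) gchoose k))"
proof -
  \<comment> \<open>Negating the upper index absorbs the sign that came from substituting $-t$.\<close>
  have "(-1) ^ k * ((lam - 1) gchoose k) = (real k - lam) gchoose k"
    using gbinomial_negated_upper[of "real k - lam" k] by simp
  moreover have "(real k - lam) gchoose k = pochhammer (1 - lam) k / fact k"
    using gbinomial_pochhammer'[of "real k - lam" k] by simp
  ultimately show ?thesis
    by (simp add: degenerate_harmonic_eq_gbinomial diff_divide_distrib mult.commute)
qed

end
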